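(* Let $H$ be a separable, infinite-dimensional real Hilbert space, let $\mathcal{E}=\{e_i\}_{i=1}^{\infty}$ be an orthonormal basis of $H$, let $\mathcal{D}:=\mathcal{E}^{\pm}=\{e_i\}_{i=1}^{\infty}\cup\{-e_i\}_{i=1}^{\infty}$, and let $t\in(0,1)$. Then there exist an element $f\in H$ and a sequence of positive real numbers $\{c_n\}_{n=1}^\infty$ with $c_n\to 0$ and $\sum_{n=1}^{\infty}c_n=\infty$, such that some greedy expansion of $f$ in the dictionary $\mathcal{D}$ with prescribed coefficients $\{c_n\}_{n=1}^{\infty}$ and weakening parameter $t$ does not converge to $f$.
   Context: Let $H$ be a real Hilbert space with inner product $\langle\cdot,\cdot\rangle$. A dictionary $\mathcal{D}\subset H$ is a set of unit-norm vectors whose linear span is dense in $H$. Greedy expansion with prescribed coefficients $C=\{c_n\}_{n=1}^\infty$, $c_n>0$, and weakening parameter $t\in(0,1]$. For $f\in H$ put $f_0:=f$, $G_0:=0$. For $m\ge 1$, if $f_{m-1}\neq 0$, choose an element $\varphi_m\in\mathcal{D}$ such that $\langle f_{m-1},\varphi_m\rangle\ge t\sup_{g\in\mathcal{D}}\langle f_{m-1},g\rangle$, and set $f_m:=f_{m-1}-c_m\varphi_m$, $G_m:=G_{m-1}+c_m\varphi_m$. The series $\sum_n c_n\varphi_n$ is called a greedy expansion of $f$. If $f_{m-1}=0$ the algorithm stops; the expansion is then the finite sum $G_{m-1}=f$ and is regarded as converging to $f$. The choice of $\varphi_m$ need not be unique, so $f$ may have several greedy expansions. A greedy expansion converges to $f$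 if $\lim_{m\to\infty}G_m=f$ in norm, i.e. $\lim_{m\to\infty}\|f_m\|=0$. *)

theory Defs
  imports "HOL-Analysis.Analysis"
begin

text \<open>
  A real Hilbert space is a type of class \<open>{real_inner, complete_space}\<close>.
\<close>

definition infinite_dimensional :: "'a::real_vector itself \<Rightarrow> bool" where
  "infinite_dimensional _ \<longleftrightarrow> \<not> (\<exists>B :: 'a set. finite B \<and> span B = UNIV)"

definition dictionary :: "'a::real_inner set \<Rightarrow> bool" where
  "dictionary D \<longleftrightarrow> (\<forall>g\<in>D. norm g = 1) \<and> closure (span D) = UNIV"

definition orthonormal_basis :: "('i \<Rightarrow> 'a::real_inner) \<Rightarrow> bool" where
  "orthonormal_basis e \<longleftrightarrow>
     (\<forall>i j. e i \<bullet> e j = (if i = j then 1 else 0)) \<and> closure (span (range e)) = UNIV"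

definition symmetrized :: "('i \<Rightarrow> 'a::real_inner) \<Rightarrow> 'a set" where
  "symmetrized e = range e \<union> range (\<lambda>i. - e i)"

text \<open>
  Coefficients \<open>c\<close> and chosen elements \<open>\<phi>\<close> are indexed from 1; \<open>c 0\<close> and \<open>\<phi> 0\<close> are never used.
  If the algorithm stops, i.e. some remainder is 0, then the remainder and the approximant
  are constant from there on, and the later values of \<open>\<phi>\<close> are irrelevant.
  So a finite expansion converges in the sense below.
\<close>

primrec greedy_remainder :: "(nat \<Rightarrow> real) \<Rightarrow> (nat \<Rightarrow> 'a::real_inner) \<Rightarrow> 'a \<Rightarrow> nat \<Rightarrow> 'a" where
  "greedy_remainder c \<phi> f 0 = f"
| "greedy_remainder c \<phi> f (Suc m) =
     (if greedy_remainder c \<phi> f m = 0 then 0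
      else greedy_remainder c \<phi> f m - c (Suc m) *\<^sub>R \<phi> (Suc m))"

primrec greedy_approximant :: "(nat \<Rightarrow> real) \<Rightarrow> (nat \<Rightarrow> 'a::real_inner) \<Rightarrow> 'a \<Rightarrow> nat \<Rightarrow> 'a" where
  "greedy_approximant c \<phi> f 0 = 0"
| "greedy_approximant c \<phi> f (Suc m) =
     (if greedy_remainder c \<phi> f m = 0 then greedy_approximant c \<phi> f m
      else greedy_approximant c \<phi> f m + c (Suc m) *\<^sub>R \<phi> (Suc m))"

text \<open>
  For a dictionary the supremum is over a bounded set (\<open>norm g = 1\<close>), which is nonempty
  as soon as a nonzero remainder exists, so the real-valued \<open>SUP\<close> is the true supremum.
\<close>

definition greedy_expansion ::
  "'a::real_inner set \<Rightarrow> real \<Rightarrow> (nat \<Rightarrow> real) \<Rightarrow> 'a \<Rightarrow> (nat \<Rightarrow> 'a) \<Rightarrow> bool" where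
  "greedy_expansion D t c f \<phi> \<longleftrightarrow>
     (\<forall>m\<ge>1. greedy_remainder c \<phi> f (m - 1) \<noteq> 0 \<longrightarrow>
        \<phi> m \<in> D \<and>
        greedy_remainder c \<phi> f (m - 1) \<bullet> \<phi> m
          \<ge> t * (SUP g\<in>D. greedy_remainder c \<phi> f (m - 1) \<bullet> g))"

definition expansion_converges ::
  "(nat \<Rightarrow> real) \<Rightarrow> (nat \<Rightarrow> 'a::real_inner) \<Rightarrow> 'a \<Rightarrow> bool" where
  "expansion_converges c \<phi> f \<longleftrightarrow> greedy_approximant c \<phi> f \<longlonglongrightarrow> f"

lemma greedy_approximant_plus_remainder:
  "greedy_approximant c \<phi> f m + greedy_remainder c \<phi> f m = f"
  by (induction m) auto

lemma expansion_converges_iff_remainder: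
  "expansion_converges c \<phi> f \<longleftrightarrow> (\<lambda>m. norm (greedy_remainder c \<phi> f m)) \<longlonglongrightarrow> 0"
proof -
  have "greedy_remainder c \<phi> f m = f - greedy_approximant c \<phi> f m" for m
    using greedy_approximant_plus_remainder[of c \<phi> f m] by (simp add: algebra_simps)
  then show ?thesis
    unfolding expansion_converges_def
    by (subst LIMSEQ_iff, subst LIMSEQ_iff) (simp add: norm_minus_commute)
qed

lemma dictionary_symmetrized:
  assumes "orthonormal_basis e"
  shows "dictionary (symmetrized e)"
proof -
  have "closure (span (range e)) \<subseteq> closure (span (symmetrized e))"
    by (intro closure_mono span_mono) (auto simp: symmetrized_def)
  then show ?thesis
    using assms
    by (auto simp: dictionary_def orthonormal_basis_def symmetrized_def norm_eq_1)
qed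

end

theory Submission
  imports Defs
begin

text \<open>
  Start from \<open>f = (\<Sum>j. t ^ j *\<^sub>R e j)\<close> and let only the absolute values of the coordinates matter.
  A coordinate of absolute value \<open>a\<close> to which the coefficient \<open>a + b\<close> is applied gets absolute
  value \<open>b\<close>, so if \<open>b \<le> a / t\<close>, then \<open>n\<close> coordinates of absolute value \<open>a\<close> can be moved one after
  another to the absolute value \<open>b\<close>: the weak greedy condition tolerates the factor \<open>1 / t\<close>.
  The first \<open>n\<close> coordinates can therefore be blown up by the factor \<open>1 / t\<close> again and again until
  \<open>n * a\<^sup>2 \<ge> 1\<close>. Then they are all dropped to \<open>t ^ n\<close>, the absolute value of the first coordinate
  not touched so far, and the procedure is repeated with \<open>n + 1\<close> coordinates. The remainder has
  norm at least 1 infinitely often, while the coefficients are at most of order \<open>1 / sqrt n\<close>.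
  Their sum diverges: leaving the value \<open>a\<close> costs at least \<open>n * a\<close>, which is at least \<open>1 / a\<close>
  whenever \<open>n * a\<^sup>2 \<ge> 1\<close>.
\<close>

section \<open>Orthonormal systems\<close>

text \<open>Expand the squared norm of \<open>x - p\<close>, where \<open>p\<close> is the
  projection of \<open>x\<close> onto the span of the \<open>e i\<close>.\<close>

lemma orthonormal_finite_Bessel:
  fixes x :: "'a::real_inner"
  assumes orth: "\<And>i j. e i \<bullet> e j = (if i = j then 1 else 0)" and "finite I"
  shows "(\<Sum>i\<in>I. (x \<bullet> e i)\<^sup>2) \<le> (norm x)\<^sup>2"
proof -
  define p where "p = (\<Sum>i\<in>I. (x \<bullet> e i) *\<^sub>R e i)"
  have "x \<bullet> p = (\<Sum>i\<in>I. (x \<bullet> e i)\<^sup>2)"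
    by (simp add: p_def inner_sum_right power2_eq_square)
  moreover have "p \<bullet> p = (\<Sum>i\<in>I. (x \<bullet> e i)\<^sup>2)"
    using \<open>finite I\<close>
    by (simp add: p_def inner_sum_right inner_sum_left orth power2_eq_square if_distrib cong: if_cong)
  moreover have "0 \<le> (x - p) \<bullet> (x - p)"
    by simp
  ultimately show ?thesis
    by (simp add: inner_diff_left inner_diff_right inner_commute power2_norm_eq_inner)
qed

text \<open>Increments of the partial sums \<open>s\<close> are dominated by those of the series of
  absolute values, so \<open>s\<close> is Cauchy and completeness supplies the limit.\<close>

lemma orthonormal_expansion_exists:
  fixes e :: "nat \<Rightarrow> 'a::{real_inner, complete_space}"
  assumes orth: "\<And>i j. e i \<bullet> e j = (if i = j then 1 else 0)"
    and sum: "summable (\<lambda>j. \<bar>y j\<bar>)"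
  obtains f where "\<And>j. f \<bullet> e j = y j"
proof -
  define s where "s n = (\<Sum>j<n. y j *\<^sub>R e j)" for n
  have e1: "norm (e j) = 1" for j
    by (simp add: norm_eq_1 orth)
  have diff: "dist (s m) (s n) \<le> dist (\<Sum>j<m. \<bar>y j\<bar>) (\<Sum>j<n. \<bar>y j\<bar>)" if "m \<le> n" for m n
  proof -
    have sd: "(\<Sum>j<n. h j) - (\<Sum>j<m. h j) = (\<Sum>j=m..<n. h j)" for h :: "nat \<Rightarrow> 'b::ab_group_add"
      using sum_diff_nat_ivl[of 0 m n h] that by (simp add: atLeast0LessThan)
    have "dist (s m) (s n) = norm (s n - s m)"
      by (metis dist_norm norm_minus_commute)
    also have "s n - s m = (\<Sum>j=m..<n. y j *\<^sub>R e j)"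
      by (simp add: s_def sd)
    also have "norm \<dots> \<le> (\<Sum>j=m..<n. \<bar>y j\<bar>)"
      by (rule sum_norm_le) (simp add: e1)
    also have "\<dots> = (\<Sum>j<n. \<bar>y j\<bar>) - (\<Sum>j<m. \<bar>y j\<bar>)"
      by (simp only: sd)
    also have "\<dots> \<le> dist (\<Sum>j<m. \<bar>y j\<bar>) (\<Sum>j<n. \<bar>y j\<bar>)"
      by (simp only: dist_real_def abs_minus_commute[of "sum _ {..<m}"] abs_ge_self)
    finally show ?thesis .
  qed
  have "Cauchy (\<lambda>n. \<Sum>j<n. \<bar>y j\<bar>)"
    using sum by (simp add: summable_iff_convergent convergent_Cauchy)
  moreover have "dist (s m) (s n) \<le> dist (\<Sum>j<m. \<bar>y j\<bar>) (\<Sum>j<n. \<bar>y j\<bar>)" for m n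
    by (metis diff dist_commute nat_le_linear)
  ultimately have "Cauchy s"
    unfolding Cauchy_def by (meson le_less_trans)
  then obtain f where f: "s \<longlonglongrightarrow> f"
    using Cauchy_convergent convergent_def by blast
  have "f \<bullet> e j = y j" for j
  proof (rule LIMSEQ_unique)
    show "(\<lambda>n. s n \<bullet> e j) \<longlonglongrightarrow> f \<bullet> e j"
      by (intro tendsto_intros f)
    have "s n \<bullet> e j = y j" if "Suc j \<le> n" for n
      using that by (simp add: s_def inner_sum_left orth if_distrib cong: if_cong)
    then show "(\<lambda>n. s n \<bullet> e j) \<longlonglongrightarrow> y j"
      by (rule tendsto_eventually[OF eventually_sequentiallyI])
  qed
  then show thesis
    by (rule that)
qed

section \<open>The order in which coordinates are visited\<close>

text \<open>
  Position \<open>(r, i)\<close> means that in round \<open>r\<close>, which treats the coordinates \<open>0, \<dots>, N r - 1\<close> in turn,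
  coordinate \<open>i\<close> is next.
\<close>

primrec position :: "(nat \<Rightarrow> nat) \<Rightarrow> nat \<Rightarrow> nat \<times> nat" where
  "position N 0 = (0, 0)"
| "position N (Suc m) =
     (case position N m of (r, i) \<Rightarrow> if Suc i < N r then (r, Suc i) else (Suc r, 0))"

lemma position_less:
  assumes "\<And>r. 0 < N r" and "position N m = (r, i)"
  shows "i < N r"
  using assms by (cases m) (auto split: prod.splits if_splits)

lemma position_round_le: "fst (position N m) \<le> m"
  by (induction m) (auto split: prod.splits)

lemma position_mono: "mono (\<lambda>m. fst (position N m))"
  by (intro mono_iff_le_Suc[THEN iffD2] allI) (auto split: prod.splits)

lemma position_reaches:
  assumes pos: "\<And>r. 0 < N r"
  shows "\<exists>m. position N m = (r, 0)"
proof (induction r)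
  case 0
  show ?case by (rule exI[of _ 0]) simp
next
  case (Suc r)
  then obtain m where m: "position N m = (r, 0)"
    by blast
  have "position N (m + i) = (r, i)" if "i < N r" for i
    using that by (induction i) (simp_all add: m)
  moreover obtain k where "N r = Suc k"
    using pos[of r] gr0_conv_Suc by blast
  ultimately have "position N (Suc (m + k)) = (Suc r, 0)"
    by simp
  then show ?case ..
qed

lemma position_round_at_top:
  assumes "\<And>r. 0 < N r"
  shows "filterlim (\<lambda>m. fst (position N m)) at_top sequentially"
  unfolding filterlim_at_top
proof
  fix r
  obtain m where "position N m = (r, 0)"
    using position_reaches[of N, OF assms] by blast
  then have "r \<le> fst (position N m')" if "m \<le> m'" for m'
    using monoD[OF position_mono that, of N] by simp
  then show "\<forall>\<^sub>F m in sequentially. r \<le> fst (position N m)"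
    by (rule eventually_sequentiallyI)
qed

section \<open>Sizes and values of the rounds\<close>

text \<open>
  The first component is the number of coordinates touched in a round, the second one their common
  absolute value at the beginning of the round.
\<close>

primrec stage :: "real \<Rightarrow> nat \<Rightarrow> nat \<times> real" where
  "stage t 0 = (1, 1)"
| "stage t (Suc r) =
     (case stage t r of (n, a) \<Rightarrow> if 1 \<le> real n * a\<^sup>2 then (Suc n, t ^ n) else (n, a / t))"

locale weak_greedy_orthonormal =
  fixes e :: "nat \<Rightarrow> 'a::real_inner" and t :: real and f :: 'a
  assumes orth: "e i \<bullet> e j = (if i = j then 1 else 0)"
    and t_pos: "0 < t" and t_less_1: "t < 1"
    and f_coord: "f \<bullet> e j = t ^ j"
begin

definition N :: "nat \<Rightarrow> nat" where "N r = fst (stage t r)"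

definition A :: "nat \<Rightarrow> real" where "A r = snd (stage t r)"

lemma N_0 [simp]: "N 0 = 1" and A_0 [simp]: "A 0 = 1"
  by (simp_all add: N_def A_def)

lemma N_Suc: "N (Suc r) = (if 1 \<le> real (N r) * (A r)\<^sup>2 then Suc (N r) else N r)"
  and A_Suc: "A (Suc r) = (if 1 \<le> real (N r) * (A r)\<^sup>2 then t ^ N r else A r / t)"
  by (simp_all add: N_def A_def split: prod.split)

lemma N_pos: "0 < N r"
  by (induction r) (auto simp: N_Suc)

lemma A_pos: "0 < A r"
  by (induction r) (auto simp: A_Suc t_pos)

lemma A_le_div: "A r \<le> A r / t"
  using A_pos[of r] t_pos t_less_1 by (simp add: field_simps)

text \<open>This keeps untouched coordinates from dominating: the largest of them is
  \<open>t ^ N r\<close>. A drop sets the value to \<open>t ^ n\<close> while the size becomes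
  \<open>n + 1\<close>; otherwise the value only grows.\<close>

lemma power_N_le_A: "t ^ N r \<le> A r"
proof (induction r)
  case 0
  show ?case using t_less_1 by simp
next
  case (Suc r)
  have "t * t ^ N r \<le> 1 * t ^ N r"
    using t_pos t_less_1 by (intro mult_right_mono) auto
  then show ?case
    using Suc A_le_div[of r] by (auto simp: N_Suc A_Suc)
qed

lemma A_Suc_le: "A (Suc r) \<le> A r / t"
  using order_trans[OF power_N_le_A A_le_div, of r] by (simp add: A_Suc)

text \<open>While the threshold is missed, \<open>A\<close> grows geometrically with ratio
  \<open>1 / t\<close>; since \<open>N\<close> is at least 1, \<open>A > 1\<close> already exceeds
  the threshold.\<close>

lemma frequently_large: "\<exists>q\<ge>r. 1 \<le> real (N q) * (A q)\<^sup>2"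
proof (rule ccontr)
  assume "\<not> ?thesis"
  then have small: "real (N q) * (A q)\<^sup>2 < 1" if "r \<le> q" for q
    using that by force
  have A_eq: "A (r + k) = A r * (1 / t) ^ k" for k
  proof (induction k)
    case (Suc k)
    have "A (r + Suc k) = A (r + k) / t"
      using small[of "r + k"] by (simp add: A_Suc)
    with Suc show ?case
      by simp
  qed simp
  obtain k where k: "1 / A r < (1 / t) ^ k"
    using real_arch_pow[of "1 / t" "1 / A r"] t_pos t_less_1 by auto
  then have "1 < A r * (1 / t) ^ k"
    using A_pos[of r] by (simp add: field_simps)
  then have "1 < A (r + k)"
    by (simp add: A_eq)
  then have "1 < (A (r + k))\<^sup>2"
    by simp
  moreover have "1 \<le> real (N (r + k))"
    using N_pos[of "r + k"] by linarith
  ultimately have "1 * 1 \<le> real (N (r + k)) * (A (r + k))\<^sup>2"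
    by (intro mult_mono) auto
  with small[of "r + k"] show False
    by simp
qed

lemma N_mono: "mono N"
  by (intro mono_iff_le_Suc[THEN iffD2] allI) (auto simp: N_Suc)

lemma N_at_top: "filterlim N at_top sequentially"
  unfolding filterlim_at_top
proof
  fix n
  have "\<exists>r. n \<le> N r"
  proof (induction n)
    case (Suc n)
    then obtain r where r: "n \<le> N r" ..
    obtain q where q: "r \<le> q" "1 \<le> real (N q) * (A q)\<^sup>2"
      using frequently_large by blast
    have "n \<le> N q"
      using r monoD[OF N_mono q(1)] by simp
    then have "Suc n \<le> N (Suc q)"
      using q(2) by (simp add: N_Suc)
    then show ?case ..
  qed simp
  then obtain r where "n \<le> N r" ..
  then have "n \<le> N q" if "r \<le> q" for q
    using monoD[OF N_mono that] by simp
  then show "\<forall>\<^sub>F r in sequentially. n \<le> N r"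
    by (rule eventually_sequentiallyI)
qed

text \<open>Each summand covers one way of entering round \<open>r\<close>: after a drop
  \<open>A r = t ^ (N r - 1)\<close>; after a blow-up the previous value was below
  \<open>1 / sqrt (N r)\<close> and was divided by \<open>t\<close>.\<close>

lemma A_le: "A r \<le> t ^ N r / t + 1 / (t * sqrt (real (N r)))"
proof (cases r)
  case 0
  then show ?thesis using t_pos by simp
next
  case (Suc q)
  show ?thesis
  proof (cases "1 \<le> real (N q) * (A q)\<^sup>2")
    case True
    then have "A r = t ^ N r / t"
      using t_pos by (simp add: Suc N_Suc A_Suc)
    then show ?thesis
      using t_pos by simp
  next
    case False
    then have "sqrt (real (N q)) * A q \<le> 1"
      using A_pos[of q] real_sqrt_le_mono[of "real (N q) * (A q)\<^sup>2" 1]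
      by (simp add: real_sqrt_mult)
    then have "A q / t \<le> 1 / (t * sqrt (real (N q)))"
      using t_pos N_pos[of q] by (simp add: field_simps)
    with False show ?thesis
      using t_pos by (simp add: Suc N_Suc A_Suc add_increasing)
  qed
qed

lemma A_tendsto_0: "A \<longlonglongrightarrow> 0"
proof -
  have "(\<lambda>n. t ^ n / t + 1 / (t * sqrt (real n))) \<longlonglongrightarrow> 0 / t + 0"
  proof (rule tendsto_add[OF tendsto_divide[OF _ tendsto_const]])
    show "(\<lambda>n. t ^ n) \<longlonglongrightarrow> 0"
      using t_pos t_less_1 by (intro LIMSEQ_power_zero) auto
    have "filterlim (\<lambda>n. t * sqrt (real n)) at_top sequentially"
      by (intro filterlim_tendsto_pos_mult_at_top[OF tendsto_const t_pos]
            filterlim_compose[OF sqrt_at_top filterlim_real_sequentially])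
    then show "(\<lambda>n. 1 / (t * sqrt (real n))) \<longlonglongrightarrow> 0"
      by (intro tendsto_divide_0[OF tendsto_const] filterlim_at_top_imp_at_infinity)
  qed (use t_pos in simp)
  from filterlim_compose[OF this N_at_top]
  have "(\<lambda>r. t ^ N r / t + 1 / (t * sqrt (real (N r)))) \<longlonglongrightarrow> 0"
    by simp
  then show ?thesis
    by (rule Lim_null_comparison[rotated]) (use A_le A_pos in \<open>auto simp: less_imp_le\<close>)
qed

section \<open>The remainders and the greedy condition\<close>

abbreviation round :: "nat \<Rightarrow> nat" where "round m \<equiv> fst (position N m)"

abbreviation index :: "nat \<Rightarrow> nat" where "index m \<equiv> snd (position N m)"

text \<open>The coefficient carries a coordinate of absolute value \<open>A r\<close> past zero to
  absolute value \<open>A (Suc r)\<close>. Step \<open>m\<close> starts from position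
  \<open>m - 1\<close> because coefficients are numbered from 1.\<close>

definition coeff :: "nat \<Rightarrow> real" where
  "coeff m = A (round (m - 1)) + A (Suc (round (m - 1)))"

text \<open>There is no stopping clause here; \<open>rest_nonzero\<close> later shows that the
  algorithm never stops.\<close>

primrec rest :: "nat \<Rightarrow> 'a" where
  "rest 0 = f"
| "rest (Suc m) = rest m - coeff (Suc m) *\<^sub>R (sgn (rest m \<bullet> e (index m)) *\<^sub>R e (index m))"

definition choice :: "nat \<Rightarrow> 'a" where
  "choice m = sgn (rest (m - 1) \<bullet> e (index (m - 1))) *\<^sub>R e (index (m - 1))"

lemma index_less: "index m < N (round m)"
  by (rule position_less) (simp_all add: N_pos)

text \<open>The invariant of the construction: within a round, coordinates before
  \<open>index m\<close> already have the next value, the other active ones still have the old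
  value, and the rest are untouched.\<close>

lemma abs_coord_rest:
  "\<bar>rest m \<bullet> e j\<bar> =
     (if j < index m then A (Suc (round m)) else if j < N (round m) then A (round m) else t ^ j)"
proof (induction m arbitrary: j)
  case 0
  then show ?case using t_pos by (simp add: f_coord)
next
  case (Suc m)
  obtain r i where p: "position N m = (r, i)"
    by fastforce
  have i: "i < N r"
    using index_less[of m] by (simp add: p)
  have ri: "\<bar>rest m \<bullet> e i\<bar> = A r"
    using Suc[of i] i by (simp add: p)
  have flip: "\<bar>x - (\<bar>x\<bar> + b) * sgn x\<bar> = b" if "x \<noteq> 0" "0 < b" for x b :: real
    using that by (simp add: sgn_if algebra_simps)
  have "rest (Suc m) \<bullet> e j
      = rest m \<bullet> e j - (if j = i then (A r + A (Suc r)) * sgn (rest m \<bullet> e i) else 0)"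
    by (simp add: p coeff_def inner_diff_left orth)
  then have "\<bar>rest (Suc m) \<bullet> e j\<bar> = (if j = i then A (Suc r) else \<bar>rest m \<bullet> e j\<bar>)"
    using flip[of "rest m \<bullet> e i" "A (Suc r)"] A_pos[of r] A_pos[of "Suc r"] ri by auto
  then have step: "\<bar>rest (Suc m) \<bullet> e j\<bar> =
      (if j < Suc i then A (Suc r) else if j < N r then A r else t ^ j)"
    using Suc[of j] i by (simp add: p less_Suc_eq)
  show ?case
  proof (cases "Suc i < N r")
    case True
    with step show ?thesis by (simp add: p)
  next
    \<comment> \<open>The round ends. After a drop, coordinate \<open>N r\<close> becomes active;
      its untouched value \<open>t ^ N r\<close> is exactly the new common value, so the invariant
      survives.\<close>
    case False
    with i have "Suc i = N r"
      by simp
    moreover from this have "position N (Suc m) = (Suc r, 0)"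
      by (simp add: p)
    ultimately show ?thesis
      using step by (auto simp: N_Suc A_Suc less_Suc_eq)
  qed
qed

lemma abs_coord_rest_index: "\<bar>rest m \<bullet> e (index m)\<bar> = A (round m)"
  using index_less[of m] by (simp add: abs_coord_rest)

lemma abs_coord_rest_le: "\<bar>rest m \<bullet> e j\<bar> \<le> A (round m) / t"
proof -
  have "t ^ j \<le> A (round m) / t" if "N (round m) \<le> j"
  proof -
    have "t ^ j \<le> t ^ N (round m)"
      using that t_pos t_less_1 by (intro power_decreasing) auto
    then show ?thesis
      using power_N_le_A[of "round m"] A_le_div[of "round m"] by linarith
  qed
  then show ?thesis
    using A_Suc_le[of "round m"] A_le_div[of "round m"] by (simp add: abs_coord_rest)
qed

lemma rest_nonzero: "rest m \<noteq> 0"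
  using abs_coord_rest_index[of m] A_pos[of "round m"] by auto

lemma greedy_remainder_eq_rest: "greedy_remainder coeff choice f m = rest m"
  by (induction m) (simp_all add: rest_nonzero choice_def)

text \<open>The chosen coordinate has absolute value \<open>A r\<close> and no coordinate exceeds
  \<open>A r / t\<close>, so the loss is at most the permitted factor \<open>t\<close>.\<close>

lemma greedy_expansion_choice: "greedy_expansion (symmetrized e) t coeff f choice"
  unfolding greedy_expansion_def greedy_remainder_eq_rest
proof (intro allI impI conjI)
  fix m :: nat
  assume "1 \<le> m"
  define x where "x = rest (m - 1) \<bullet> e (index (m - 1))"
  have choice: "choice m = sgn x *\<^sub>R e (index (m - 1))"
    by (simp only: choice_def x_def)
  have x: "\<bar>x\<bar> = A (round (m - 1))"
    by (simp add: x_def abs_coord_rest_index)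
  then have "x \<noteq> 0"
    using A_pos[of "round (m - 1)"] by auto
  then show "choice m \<in> symmetrized e"
    by (cases "0 < x") (auto simp: choice symmetrized_def sgn_if)
  have "(SUP g\<in>symmetrized e. rest (m - 1) \<bullet> g) \<le> A (round (m - 1)) / t"
  proof (rule cSUP_least)
    fix g
    assume "g \<in> symmetrized e"
    then obtain j where "g = e j \<or> g = - e j"
      by (auto simp: symmetrized_def)
    then show "rest (m - 1) \<bullet> g \<le> A (round (m - 1)) / t"
      using abs_coord_rest_le[of "m - 1" j] by auto
  qed (simp add: symmetrized_def)
  then have "t * (SUP g\<in>symmetrized e. rest (m - 1) \<bullet> g) \<le> \<bar>x\<bar>"
    using t_pos by (simp add: x field_simps)
  also have "\<bar>x\<bar> = rest (m - 1) \<bullet> choice m"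
    by (simp only: choice inner_scaleR_right x_def[symmetric] abs_sgn mult.commute)
  finally show "t * (SUP g\<in>symmetrized e. rest (m - 1) \<bullet> g) \<le> rest (m - 1) \<bullet> choice m" .
qed

section \<open>Failure of convergence\<close>

lemma not_expansion_converges: "\<not> expansion_converges coeff choice f"
proof
  assume "expansion_converges coeff choice f"
  then have "(\<lambda>m. norm (rest m)) \<longlonglongrightarrow> 0"
    by (simp add: expansion_converges_iff_remainder greedy_remainder_eq_rest)
  then have "\<forall>\<^sub>F m in sequentially. norm (rest m) < 1"
    by (rule order_tendstoD) simp
  then obtain M where M: "norm (rest m) < 1" if "M \<le> m" for m
    by (auto simp: eventually_sequentially)
  obtain r where r: "M \<le> r" "1 \<le> real (N r) * (A r)\<^sup>2"
    using frequently_large by blast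
  obtain m where m: "position N m = (r, 0)"
    using position_reaches[of N r] N_pos by blast
  have "(rest m \<bullet> e j)\<^sup>2 = (A r)\<^sup>2" if "j < N r" for j
    using abs_coord_rest[of m j] that by (metis m fst_conv snd_conv not_less0 power2_abs)
  then have "(\<Sum>j<N r. (rest m \<bullet> e j)\<^sup>2) = real (N r) * (A r)\<^sup>2"
    by simp
  with r(2) have "1 \<le> (norm (rest m))\<^sup>2"
    using orthonormal_finite_Bessel[of e "{..<N r}" "rest m"] orth by simp
  \<comment> \<open>Each step advances the round by at most one, so round \<open>r\<close> begins no
    earlier than step \<open>r\<close>.\<close>
  moreover have "M \<le> m"
    using position_round_le[of N m] r(1) by (simp add: m)
  ultimately show False
    using M[of m] by (simp add: abs_square_less_1 not_less[symmetric])
qed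

section \<open>The coefficients\<close>

lemma coeff_pos: "0 < coeff m"
  by (simp add: coeff_def A_pos add_pos_pos)

lemma coeff_tendsto_0: "coeff \<longlonglongrightarrow> 0"
proof -
  have "(\<lambda>r. A r + A (Suc r)) \<longlonglongrightarrow> 0 + 0"
    by (intro tendsto_add A_tendsto_0 LIMSEQ_Suc)
  from filterlim_compose[OF this position_round_at_top[of N, OF N_pos]]
  have "(\<lambda>m. coeff (Suc m)) \<longlonglongrightarrow> 0"
    by (simp add: coeff_def)
  then show ?thesis
    by (rule LIMSEQ_imp_Suc)
qed

text \<open>Each step of round \<open>q\<close> costs at least \<open>A q\<close>, the value being
  left, so a complete round costs at least \<open>N q * A q\<close>.\<close>

lemma sum_coeff_ge:
  "(\<Sum>q<round m. real (N q) * A q) + real (index m) * A (round m) \<le> (\<Sum>n=1..m. coeff n)"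
proof (induction m)
  case (Suc m)
  obtain r i where p: "position N m = (r, i)"
    by fastforce
  have i: "i < N r"
    using index_less[of m] by (simp add: p)
  have "A r \<le> coeff (Suc m)"
    using A_pos[of "Suc r"] by (simp add: coeff_def p)
  with Suc have "(\<Sum>q<r. real (N q) * A q) + real (Suc i) * A r \<le> (\<Sum>n=1..Suc m. coeff n)"
    by (simp add: p algebra_simps)
  moreover have "N r = Suc i" if "\<not> Suc i < N r"
    using i that by simp
  ultimately show ?case
    by (auto simp: p)
qed simp

lemma sum_coeff_at_top: "filterlim (\<lambda>m. \<Sum>n=1..m. coeff n) at_top sequentially"
proof -
  have mono: "(\<Sum>n=1..m. coeff n) \<le> (\<Sum>n=1..m'. coeff n)" if "m \<le> m'" for m m'
    using that coeff_pos by (intro sum_mono2) (auto simp: less_imp_le)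
  have unbounded: "\<exists>m. K \<le> (\<Sum>n=1..m. coeff n)" for K
  proof (rule ccontr)
    assume "\<nexists>m. K \<le> (\<Sum>n=1..m. coeff n)"
    then have bound: "(\<Sum>n=1..m. coeff n) \<le> K" for m
      by (meson linear)
    have "(\<Sum>q<r. real (N q) * A q) \<le> K" for r
    proof -
      obtain m where "position N m = (r, 0)"
        using position_reaches[of N r] N_pos by blast
      then show ?thesis
        using sum_coeff_ge[of m] bound[of m] by simp
    qed
    then have "summable (\<lambda>q. real (N q) * A q)"
      using A_pos by (intro summableI_nonneg_bounded[where x = K]) (auto simp: less_imp_le)
    \<comment> \<open>Terms of a summable series tend to 0, and so does \<open>A\<close>; their
      product would then stay below the threshold that \<open>frequently_large\<close> says is
      reached again and again.\<close>
    then have "(\<lambda>q. real (N q) * A q * A q) \<longlonglongrightarrow> 0 * 0"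
      by (intro tendsto_mult A_tendsto_0 summable_LIMSEQ_zero)
    then have "\<forall>\<^sub>F q in sequentially. real (N q) * (A q)\<^sup>2 < 1"
      by (intro order_tendstoD(2)[where y = 0]) (simp_all add: power2_eq_square mult.assoc)
    then show False
      using frequently_large by (meson eventually_sequentially not_less)
  qed
  show ?thesis
    unfolding filterlim_at_top
  proof
    fix K
    obtain m where "K \<le> (\<Sum>n=1..m. coeff n)"
      using unbounded by blast
    then have "K \<le> (\<Sum>n=1..m'. coeff n)" if "m \<le> m'" for m'
      using mono[OF that] by simp
    then show "\<forall>\<^sub>F m in sequentially. K \<le> (\<Sum>n=1..m. coeff n)"
      by (rule eventually_sequentiallyI)
  qed
qed

end

theorem theorem3p4:
  fixes e :: "nat \<Rightarrow> 'a::{real_inner, complete_space}"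
    and t :: real
  assumes "separable_space (euclidean :: 'a topology)"
    and "infinite_dimensional TYPE('a)"
    and "orthonormal_basis e"
    and "0 < t" and "t < 1"
  shows "\<exists>(f :: 'a) (c :: nat \<Rightarrow> real).
           (\<forall>n\<ge>1. c n > 0) \<and>
           c \<longlonglongrightarrow> 0 \<and>
           filterlim (\<lambda>N. \<Sum>n=1..N. c n) at_top sequentially \<and>
           (\<exists>\<phi>. greedy_expansion (symmetrized e) t c f \<phi> \<and> \<not> expansion_converges c \<phi> f)"
proof -
  have orth: "e i \<bullet> e j = (if i = j then 1 else 0)" for i j
    using assms(3) by (simp add: orthonormal_basis_def)
  have "summable (\<lambda>j. \<bar>t ^ j\<bar>)"
    using assms(4,5) by (simp add: summable_geometric)
  then obtain f where "\<And>j. f \<bullet> e j = t ^ j"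
    using orthonormal_expansion_exists[of e "\<lambda>j. t ^ j"] orth by blast
  then interpret weak_greedy_orthonormal e t f
    by unfold_locales (simp_all add: orth assms(4,5))
  show ?thesis
    using coeff_pos coeff_tendsto_0 sum_coeff_at_top greedy_expansion_choice
      not_expansion_converges by blast
qed

end
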